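(* For integers $n\ge 0$ let $$C(n)=\frac{1}{n+1}\binom{2n}{n},\qquad M(n)=\sum_{k=0}^n\binom{n}{2k}C(k),\qquad S(n)=\sum_{k=0}^n\binom{n+k}{2k}C(k)$$ be the Catalan numbers, the Motzkin numbers and the large Schröder numbers, respectively. Then the following sequences are not almost realizable: (1) $(C(n))_{n=1}^\infty$; (2) $(M(n))_{n=1}^\infty$; (3) $(S(n))_{n=1}^\infty$.
   Context: A sequence $a=(a(n))_{n=1}^\infty$ of non-negative integers is called realizable if one of the following two equivalent conditions holds: (1) there is a self-map $T:X\to X$ on a set $X$ such that $a(n)=\#\{x\in X: T^n(x)=x\}$ for all $n\ge 1$; (2) for all $n\ge 1$, $(\mu*a)(n)=\sum_{d\mid n}\mu(n/d)\,a(d)$ is a non-negative integer divisible by $n$, where $\mu$ is the classical Möbius function and $*$ is Dirichlet convolution. The sequence $a$ is called almost realizable if there exists a positive integer $m$ such that $(m\,a(n))_{n=1}^\infty$ is realizable. Binomial coefficients $\binom{n}{2k}$ with $2k>n$ are $0$. *)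

theory Defs
  imports Complex_Main "HOL-Computational_Algebra.Computational_Algebra"
begin

definition moebius_mu :: "nat \<Rightarrow> int" where
  "moebius_mu n = (if squarefree n then (- 1) ^ card (prime_factors n) else 0)"

text \<open>A sequence indexed by the positive integers is a function on \<^typ>\<open>nat\<close>
  whose value at 0 is ignored: every divisor \<open>d\<close> of \<open>n \<ge> 1\<close> is positive.\<close>

definition dirichlet_mu :: "(nat \<Rightarrow> nat) \<Rightarrow> nat \<Rightarrow> int" where
  "dirichlet_mu a n = (\<Sum>d | d dvd n. moebius_mu (n div d) * int (a d))"

definition realizable :: "(nat \<Rightarrow> nat) \<Rightarrow> bool" where
  "realizable a \<longleftrightarrow> (\<forall>n\<ge>1. dirichlet_mu a n \<ge> 0 \<and> int n dvd dirichlet_mu a n)"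

definition almost_realizable :: "(nat \<Rightarrow> nat) \<Rightarrow> bool" where
  "almost_realizable a \<longleftrightarrow> (\<exists>m\<ge>1. realizable (\<lambda>n. m * a n))"

definition catalan :: "nat \<Rightarrow> nat" where
  "catalan n = ((2 * n) choose n) div (n + 1)"

text \<open>The division is exact.\<close>

lemma Suc_dvd_central_binomial: "(n + 1) dvd ((2 * n) choose n)"
proof -
  have "Suc n * ((2 * n) choose Suc n) = n * ((2 * n) choose n)"
    using binomial_absorption[of n "2 * n"] binomial_absorb_comp[of "2 * n" n]
    by (cases "n = 0") auto
  then have "Suc n dvd n * ((2 * n) choose n)"
    by (metis dvd_triv_left)
  moreover have "coprime (Suc n) n"
    by simp
  ultimately show ?thesis
    by (simp add: coprime_dvd_mult_right_iff)
qed

lemma of_nat_catalan: "real (catalan n) = 1 / (real n + 1) * real ((2 * n) choose n)"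
  unfolding catalan_def using real_of_nat_div[OF Suc_dvd_central_binomial[of n]] by (simp add: add.commute)

definition motzkin :: "nat \<Rightarrow> nat" where
  "motzkin n = (\<Sum>k=0..n. (n choose (2 * k)) * catalan k)"

definition schroeder :: "nat \<Rightarrow> nat" where
  "schroeder n = (\<Sum>k=0..n. ((n + k) choose (2 * k)) * catalan k)"

end

theory Submission
  imports Defs "HOL-Number_Theory.Cong"
begin

text \<open>If \<open>m a\<close> is realizable, then every prime \<open>p\<close> dividing \<open>n\<close> divides \<open>m (\<mu> * a)(n)\<close>. It therefore
  suffices to find a constant \<open>c \<noteq> 0\<close> and, for each large prime \<open>p\<close>, a multiple \<open>n\<close> of \<open>p\<close> with
  \<open>(\<mu> * a)(n) \<equiv> c\<close> modulo \<open>p\<close>. For the Catalan and Schroeder numbers \<open>n = p\<close> works, with \<open>c = 1\<close>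
  and \<open>c = 2\<close>. The Motzkin numbers satisfy \<open>M(p) \<equiv> M(1)\<close>, but \<open>n = 2 p\<close> works with \<open>c = 1\<close>.\<close>

lemma dirichlet_mu_mult: "dirichlet_mu (\<lambda>n. m * a n) n = int m * dirichlet_mu a n"
  by (simp add: dirichlet_mu_def sum_distrib_left algebra_simps)

text \<open>Realizability of \<open>m * a\<close> forces \<open>p\<close> to divide
  \<open>m * c\<close> for every large prime \<open>p\<close>, which is impossible for a fixed
  nonzero integer.\<close>

lemma not_almost_realizableI:
  fixes c :: int
  assumes "c \<noteq> 0"
    and n: "\<And>p. prime p \<Longrightarrow> p > N \<Longrightarrow> \<exists>n\<ge>1. p dvd n \<and> [dirichlet_mu a n = c] (mod int p)"
  shows "\<not> almost_realizable a"
proof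
  assume "almost_realizable a"
  then obtain m where "m \<ge> 1" and m: "realizable (\<lambda>n. m * a n)"
    by (auto simp: almost_realizable_def)
  \<comment> \<open>Exceeding \<open>N\<close> makes the hypothesis applicable; exceeding the
    absolute value of \<open>m * c\<close> rules out divisibility.\<close>
  obtain p where p: "prime p" "p > max N (m * nat \<bar>c\<bar>)"
    using bigger_prime by blast
  then obtain k where k: "k \<ge> 1" "p dvd k" "[dirichlet_mu a k = c] (mod int p)"
    using n[of p] by auto
  have "int k dvd int m * dirichlet_mu a k"
    using m k(1) by (simp add: realizable_def dirichlet_mu_mult)
  then have "int p dvd int m * dirichlet_mu a k"
    using k(2) by (meson dvd_trans int_dvd_int_iff)
  moreover have "[int m * dirichlet_mu a k = int m * c] (mod int p)"
    using k(3) by (rule cong_scalar_left)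
  ultimately have "int p dvd int m * c"
    using cong_dvd_iff by blast
  then have "int p \<le> \<bar>int m * c\<bar>"
    using \<open>m \<ge> 1\<close> \<open>c \<noteq> 0\<close> dvd_imp_le_int[of "int m * c" "int p"] by simp
  also have "\<dots> = int (m * nat \<bar>c\<bar>)"
    by (simp add: abs_mult)
  finally show False
    using p(2) by linarith
qed

section \<open>Moebius sums at a prime and at a product of two distinct primes\<close>

lemma moebius_mu_1 [simp]: "moebius_mu (Suc 0) = 1"
  by (simp add: moebius_mu_def)

lemma moebius_mu_prime: "prime p \<Longrightarrow> moebius_mu p = -1"
  by (simp add: moebius_mu_def squarefree_prime prime_prime_factors)

lemma moebius_mu_prime_mult_prime:
  assumes "prime p" "prime q" "p \<noteq> q"
  shows "moebius_mu (p * q) = 1"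
proof -
  have "squarefree (p * q)"
    using assms by (simp add: squarefree_mult_coprime primes_coprime squarefree_prime)
  moreover have "prime_factors (p * q) = {p, q}"
    using assms by (auto simp: prime_factors_product prime_prime_factors)
  ultimately show ?thesis
    using assms by (simp add: moebius_mu_def)
qed

lemma divisors_prime: "prime (p::nat) \<Longrightarrow> {d. d dvd p} = {1, p}"
  by (auto simp: prime_nat_iff)

lemma divisors_prime_mult_prime:
  fixes p q :: nat
  assumes "prime p" "prime q"
  shows "{d. d dvd p * q} = {1, p, q, p * q}"
proof -
  have "d \<in> {1, p, q, p * q}" if "d dvd p * q" for d
  proof -
    obtain b c where "d = b * c" "b dvd p" "c dvd q"
      using division_decomp[of d p q] \<open>d dvd p * q\<close> by auto
    moreover from this have "b \<in> {1, p}" "c \<in> {1, q}"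
      using assms by (simp_all add: prime_nat_iff)
    ultimately show ?thesis
      by auto
  qed
  then show ?thesis
    by auto
qed

lemma dirichlet_mu_prime:
  assumes "prime p"
  shows "dirichlet_mu a p = int (a p) - int (a 1)"
proof -
  have "p > 1" "p \<noteq> 0"
    using assms prime_gt_1_nat by auto
  then show ?thesis
    unfolding dirichlet_mu_def divisors_prime[OF assms]
    by (simp add: moebius_mu_prime[OF assms])
qed

lemma dirichlet_mu_prime_mult_prime:
  assumes "prime p" "prime q" "p \<noteq> q"
  shows "dirichlet_mu a (p * q) = int (a (p * q)) - int (a p) - int (a q) + int (a 1)"
proof -
  have "p > 1" "q > 1"
    using assms prime_gt_1_nat by auto
  then have "p \<noteq> p * q" "q \<noteq> p * q" "p \<noteq> 0" "q \<noteq> 0" "p \<noteq> 1" "q \<noteq> 1" "p * q \<noteq> 1"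
    by auto
  then show ?thesis
    unfolding dirichlet_mu_def divisors_prime_mult_prime[OF assms(1,2)] using assms
    by (simp add: moebius_mu_prime moebius_mu_prime_mult_prime)
qed

section \<open>Divisibility of binomial coefficients and reduction of sums modulo a prime\<close>

lemma prime_dvd_binomial:
  fixes p :: nat
  assumes "prime p" "p dvd n" "\<not> p dvd k"
  shows "p dvd n choose k"
proof -
  obtain j where j: "k = Suc j"
    using assms(3) by (cases k) auto
  \<comment> \<open>The right side is divisible by \<open>p\<close> because \<open>n\<close> is, and
    the factor \<open>k\<close> on the left is prime to \<open>p\<close>.\<close>
  have "k * (n choose k) = n * (n - 1 choose j)"
    unfolding j by (rule binomial_absorption)
  then have "p dvd k * (n choose k)"
    using assms(2) by simp
  then show ?thesis
    using assms(1,3) by (simp add: prime_dvd_mult_iff)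
qed

lemma cong_sum_subset:
  fixes f :: "'a \<Rightarrow> nat"
  assumes "finite A" "B \<subseteq> A" "\<And>x. x \<in> A - B \<Longrightarrow> p dvd f x"
  shows "[sum f A = sum f B] (mod p)"
proof -
  have "sum f A = sum f B + sum f (A - B)"
    using assms(1,2) by (simp add: sum.subset_diff)
  moreover have "p dvd sum f (A - B)"
    using assms(3) by (intro dvd_sum) auto
  ultimately show ?thesis
    by (simp add: cong_def mod_add_eq flip: mod_add_right_eq)
qed

section \<open>Catalan numbers modulo a prime\<close>

lemma catalan_mult: "(n + 1) * catalan n = (2 * n) choose n"
  unfolding catalan_def using Suc_dvd_central_binomial by (rule dvd_mult_div_cancel)

lemma catalan_0 [simp]: "catalan 0 = 1"
  and catalan_1 [simp]: "catalan (Suc 0) = 1"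
  by (simp_all add: catalan_def numeral_2_eq_2[symmetric] del: One_nat_def)

text \<open>The two middle entries of row \<open>2 * n + 1\<close> of Pascal's triangle agree, and
  their sum is the next central coefficient. The recurrence later evaluates the Schroeder summand at
  \<open>k = p - 1\<close>.\<close>

lemma catalan_Suc: "(n + 2) * catalan (Suc n) = 2 * (2 * n + 1) * catalan n"
proof -
  have "Suc n * ((2 * n + 1) choose n) = (2 * n + 1) * ((2 * n) choose n)"
    using binomial_absorb_comp[of "2 * n + 1" n] by simp
  also have "\<dots> = Suc n * ((2 * n + 1) * catalan n)"
    unfolding catalan_mult[symmetric] by (simp only: Suc_eq_plus1 mult.left_commute)
  finally have *: "(2 * n + 1) choose n = (2 * n + 1) * catalan n"
    unfolding mult_cancel1 by simp
  have "(2 * n + 1) choose (Suc n) = (2 * n + 1) choose n"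
    using binomial_symmetric[of "Suc n" "2 * n + 1"] by simp
  then have "(2 * Suc n) choose (Suc n) = 2 * ((2 * n + 1) choose n)"
    by simp
  then show ?thesis
    using catalan_mult[of "Suc n"] * by simp
qed

text \<open>By Vandermonde the coefficient is the sum of the squares of row \<open>p\<close>, where
  only the two end entries survive modulo \<open>p\<close>.\<close>

lemma central_binomial_prime_cong:
  assumes "prime p"
  shows "[(2 * p) choose p = 2] (mod p)"
proof -
  have p: "p > 1"
    using assms prime_gt_1_nat by auto
  have "[(\<Sum>k\<le>p. (p choose k)\<^sup>2) = (\<Sum>k\<in>{0, p}. (p choose k)\<^sup>2)] (mod p)"
  proof (rule cong_sum_subset)
    fix k assume "k \<in> {..p} - {0, p}"
    then have "p dvd p choose k"
      using assms by (intro prime_dvd_binomial) (auto dest: dvd_imp_le)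
    then show "p dvd (p choose k)\<^sup>2"
      by (simp add: power2_eq_square)
  qed auto
  then show ?thesis
    using p unfolding choose_square_sum by (simp add: numeral_2_eq_2[symmetric])
qed

lemma Suc_catalan_prime_cong:
  assumes "prime p"
  shows "[(p + 1) * catalan p = 2] (mod p)"
  using central_binomial_prime_cong[OF assms] unfolding catalan_mult .

lemma catalan_prime_cong:
  assumes "prime p"
  shows "[catalan p = 2] (mod p)"
  using Suc_catalan_prime_cong[OF assms] by (simp add: cong_def add.commute)

section \<open>Motzkin numbers at \<open>p\<close> and \<open>2 * p\<close>\<close>

lemma motzkin_cong:
  assumes "prime p" "odd p" "p dvd n"
  shows "[motzkin n = (\<Sum>k | k \<le> n \<and> p dvd k. (n choose (2 * k)) * catalan k)] (mod p)"
  unfolding motzkin_def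
proof (rule cong_sum_subset)
  fix k assume k: "k \<in> {0..n} - {k. k \<le> n \<and> p dvd k}"
  have "coprime p 2"
    using assms(2) by simp
  then have "\<not> p dvd 2 * k"
    using k by (auto simp: coprime_dvd_mult_right_iff)
  then show "p dvd (n choose (2 * k)) * catalan k"
    using assms by (intro dvd_mult2 prime_dvd_binomial)
qed auto

lemma motzkin_prime_cong:
  assumes "prime p" "odd p"
  shows "[motzkin p = 1] (mod p)"
proof -
  have p: "p > 1"
    using assms prime_gt_1_nat by auto
  \<comment> \<open>The summand at \<open>k = p\<close> vanishes since \<open>2 * p > p\<close>,
    which leaves only \<open>k = 0\<close>.\<close>
  then have "{k. k \<le> p \<and> p dvd k} = {0, p}"
    by (auto dest: dvd_imp_le)
  with p show ?thesis
    using motzkin_cong[OF assms, of p] by (simp add: binomial_eq_0)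
qed

lemma motzkin_2_prime_cong:
  assumes "prime p" "odd p"
  shows "[motzkin (2 * p) = 3] (mod p)"
proof -
  have p: "p > 1"
    using assms prime_gt_1_nat by auto
  have "k \<in> {0, p, 2 * p}" if k: "k \<le> 2 * p" "p dvd k" for k
  proof -
    obtain j where j: "k = p * j"
      using k(2) by blast
    with k(1) p have "j \<le> 2"
      by simp
    then consider "j = 0" | "j = 1" | "j = 2"
      by linarith
    then show ?thesis
      using j by cases auto
  qed
  then have "{k. k \<le> 2 * p \<and> p dvd k} = {0, p, 2 * p}"
    by auto
  \<comment> \<open>Here \<open>k = p\<close> contributes \<open>catalan p\<close>, with binomial
    factor 1, while \<open>k = 2 * p\<close> contributes 0.\<close>
  with p have "[motzkin (2 * p) = 1 + catalan p] (mod p)"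
    using motzkin_cong[OF assms, of "2 * p"] by (simp add: binomial_eq_0)
  also have "[1 + catalan p = 1 + 2] (mod p)"
    by (intro cong_add catalan_prime_cong assms) simp
  also have "1 + 2 = (3::nat)"
    by simp
  finally show ?thesis .
qed

section \<open>Schroeder numbers at \<open>p\<close>\<close>

lemma schroeder_term:
  assumes "k \<le> n"
  shows "(k + 1) * (((n + k) choose (2 * k)) * catalan k) = ((n + k) choose k) * (n choose k)"
proof -
  \<comment> \<open>This exposes the factor \<open>n choose k\<close>, which for
    \<open>n = p\<close> is divisible by \<open>p\<close> whenever \<open>0 < k < p\<close>.\<close>
  have "((n + k) choose (2 * k)) * ((2 * k) choose k) = ((n + k) choose k) * (n choose k)"
    using choose_mult[of k "2 * k" "n + k"] assms by simp
  then show ?thesis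
    by (metis catalan_mult mult.left_commute)
qed

lemma schroeder_prime_cong:
  assumes "prime p" "odd p"
  shows "[schroeder p = 4] (mod p)"
proof -
  have p: "p > 2"
    using assms prime_ge_2_nat[of p] by (cases "p = 2") auto
  define f where "f = (\<lambda>k. ((p + k) choose (2 * k)) * catalan k)"
  obtain q where q: "p = Suc q" "q > 1"
    using p by (cases p) auto
  \<comment> \<open>Besides the ends, \<open>k = q = p - 1\<close> is kept: there
    \<open>k + 1 = p\<close> cannot be cancelled modulo \<open>p\<close>.\<close>
  have "[schroeder p = sum f {0, q, p}] (mod p)"
    unfolding schroeder_def f_def[symmetric]
  proof (rule cong_sum_subset)
    fix k assume k: "k \<in> {0..p} - {0, q, p}"
    then have "p dvd p choose k"
      using assms by (intro prime_dvd_binomial) (auto dest: dvd_imp_le)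
    moreover have "(k + 1) * f k = ((p + k) choose k) * (p choose k)"
      unfolding f_def using k by (intro schroeder_term) auto
    ultimately have "p dvd (k + 1) * f k"
      by simp
    moreover have "\<not> p dvd k + 1"
      using k q by (auto dest: dvd_imp_le)
    ultimately show "p dvd f k"
      using assms(1) by (simp only: prime_dvd_mult_iff) simp
  qed (auto simp: q)
  also have "sum f {0, q, p} = 1 + f q + catalan p"
    using q by (simp add: f_def mult_2)
  also have "[1 + f q + catalan p = 1 + 1 + 2] (mod p)"
  proof (intro cong_add catalan_prime_cong assms)
    \<comment> \<open>So \<open>f q = (2 * q + 1) * catalan q\<close>, and the Catalan recurrence
      expresses \<open>2 * f q\<close> through \<open>catalan p\<close>; the 2 cancels because
      \<open>p\<close> is odd.\<close>
    have "(p + q) choose (2 * q) = 2 * q + 1"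
      using binomial_symmetric[of "2 * q" "2 * q + 1"] by (simp add: q mult_2)
    then have "2 * f q = (p + 1) * catalan p"
      using catalan_Suc[of q] by (simp add: f_def q)
    then have "[2 * f q = 2 * 1] (mod p)"
      using Suc_catalan_prime_cong[OF assms(1)] by simp
    then show "[f q = 1] (mod p)"
      using assms(2) cong_mult_lcancel_nat[of 2 p "f q" 1] by simp
  qed simp
  also have "1 + 1 + 2 = (4::nat)"
    by simp
  finally show ?thesis .
qed

theorem theorem21:
  shows "\<not> almost_realizable catalan \<and>
         \<not> almost_realizable motzkin \<and>
         \<not> almost_realizable schroeder"
proof (intro conjI)
  show "\<not> almost_realizable catalan"
  proof (rule not_almost_realizableI)
    fix p :: nat assume p: "prime p"
    have "[int (catalan p) - int (catalan 1) = int 2 - int 1] (mod int p)"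
      by (intro cong_diff cong_int_iff[THEN iffD2] catalan_prime_cong p) simp
    then show "\<exists>n\<ge>1. p dvd n \<and> [dirichlet_mu catalan n = 1] (mod int p)"
      using p prime_ge_1_nat by (intro exI[of _ p]) (simp add: dirichlet_mu_prime)
  qed simp
  show "\<not> almost_realizable motzkin"
  proof (rule not_almost_realizableI)
    \<comment> \<open>The bound makes \<open>p\<close> odd and \<open>2 * p\<close> a product of two
      distinct primes.\<close>
    fix p :: nat assume p: "prime p" "p > 2"
    have odd: "odd p"
      using p prime_odd_nat by auto
    have 1: "motzkin 1 = 1" and 2: "motzkin 2 = 2"
      by (simp_all add: motzkin_def numeral_2_eq_2)
    have "[int (motzkin (2 * p)) - int (motzkin 2) - int (motzkin p) + int (motzkin 1)
           = int 3 - int 2 - int 1 + int 1] (mod int p)"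
      unfolding 1 2
      by (intro cong_diff cong_add cong_int_iff[THEN iffD2] cong_refl motzkin_prime_cong motzkin_2_prime_cong p odd)
    then have "[dirichlet_mu motzkin (2 * p) = 1] (mod int p)"
      using p by (simp add: dirichlet_mu_prime_mult_prime)
    then show "\<exists>n\<ge>1. p dvd n \<and> [dirichlet_mu motzkin n = 1] (mod int p)"
      using p by (intro exI[of _ "2 * p"]) simp
  qed simp
  show "\<not> almost_realizable schroeder"
  proof (rule not_almost_realizableI)
    fix p :: nat assume p: "prime p" "p > 2"
    have odd: "odd p"
      using p prime_odd_nat by auto
    have 1: "schroeder 1 = 2"
      by (simp add: schroeder_def numeral_2_eq_2)
    have "[int (schroeder p) - int (schroeder 1) = int 4 - int 2] (mod int p)"
      unfolding 1 by (intro cong_diff cong_int_iff[THEN iffD2] cong_refl schroeder_prime_cong p odd)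
    then show "\<exists>n\<ge>1. p dvd n \<and> [dirichlet_mu schroeder n = 2] (mod int p)"
      using p by (intro exI[of _ p]) (simp add: dirichlet_mu_prime)
  qed simp
qed

end
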